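(* For every positive integer $n$, $$t(1,3,9;n)=t(1,3,27;3n+1)=\frac 12N(1,3,9;8n+13).$$
   Context: For positive integers $a_1,\dots,a_k$ and a nonnegative integer $n$, $N(a_1,\dots,a_k;n)$ is the number of $(x_1,\dots,x_k)\in\mathbb Z^k$ with $n=a_1x_1^2+\cdots+a_kx_k^2$, and $t(a_1,\dots,a_k;n)$ is the number of $(x_1,\dots,x_k)\in\mathbb Z^k$ with $n=a_1\frac{x_1(x_1-1)}2+\cdots+a_k\frac{x_k(x_k-1)}2$. *)

theory Defs
  imports Complex_Main
begin

text \<open>
  The coefficients \<open>a\<^sub>1, \<dots>, a\<^sub>k\<close> are the list \<open>as\<close>, and tuples in \<open>\<int>\<^sup>k\<close> are integer lists of
  the same length. For positive coefficients the counted sets are finite (proved below), so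
  \<^const>\<open>card\<close> is the true number of representations.
\<close>

definition num_sq_reps :: "nat list \<Rightarrow> nat \<Rightarrow> nat" where
  "num_sq_reps as n =
     card {xs :: int list. length xs = length as \<and>
       int n = (\<Sum>i<length as. int (as ! i) * (xs ! i)\<^sup>2)}"

text \<open>The \<open>div\<close> below is exact, since \<open>x (x - 1)\<close> is even.\<close>

definition num_tri_reps :: "nat list \<Rightarrow> nat \<Rightarrow> nat" where
  "num_tri_reps as n =
     card {xs :: int list. length xs = length as \<and>
       int n = (\<Sum>i<length as. int (as ! i) * (xs ! i * (xs ! i - 1) div 2))}"

lemma finite_reps_aux:
  fixes f :: "int \<Rightarrow> int"
  assumes pos: "\<forall>a\<in>set as. a > 0"
    and nonneg: "\<And>x. f x \<ge> 0"
    and bound: "\<And>x. \<bar>x\<bar> \<le> f x + 1"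
  shows "finite {xs. length xs = length as \<and> int n = (\<Sum>i<length as. int (as ! i) * f (xs ! i))}"
proof (rule finite_subset)
  show "finite {xs. set xs \<subseteq> {- int n - 1..int n + 1} \<and> length xs = length as}"
    by (rule finite_lists_length_eq) simp
  show "{xs. length xs = length as \<and> int n = (\<Sum>i<length as. int (as ! i) * f (xs ! i))}
    \<subseteq> {xs. set xs \<subseteq> {- int n - 1..int n + 1} \<and> length xs = length as}"
  proof (intro subsetI CollectI conjI; elim CollectE conjE)
    fix xs x
    assume len: "length xs = length as"
      and eq: "int n = (\<Sum>i<length as. int (as ! i) * f (xs ! i))"
      and "x \<in> set xs"
    then obtain i where i: "i < length as" "x = xs ! i"
      by (metis in_set_conv_nth)
    then have "as ! i > 0"
      using pos by simp
    then have "1 * f (xs ! i) \<le> int (as ! i) * f (xs ! i)"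
      by (intro mult_right_mono nonneg) simp
    also have "\<dots> \<le> (\<Sum>i<length as. int (as ! i) * f (xs ! i))"
      by (rule member_le_sum) (use i nonneg in auto)
    finally have "f x \<le> int n"
      using eq i by simp
    with bound[of x] show "x \<in> {- int n - 1..int n + 1}"
      by auto
  qed
qed

lemma finite_sq_reps:
  assumes "\<forall>a\<in>set as. a > 0"
  shows "finite {xs :: int list. length xs = length as \<and>
    int n = (\<Sum>i<length as. int (as ! i) * (xs ! i)\<^sup>2)}"
proof (rule finite_reps_aux[OF assms])
  fix x :: int
  have "0 \<le> (\<bar>x\<bar> - 1)\<^sup>2" "0 \<le> x\<^sup>2" by simp_all
  then show "\<bar>x\<bar> \<le> x\<^sup>2 + 1"
    by (simp add: power2_diff)
qed simp

lemma finite_tri_reps: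
  assumes "\<forall>a\<in>set as. a > 0"
  shows "finite {xs :: int list. length xs = length as \<and>
    int n = (\<Sum>i<length as. int (as ! i) * (xs ! i * (xs ! i - 1) div 2))}"
proof (rule finite_reps_aux[OF assms])
  fix x :: int
  have "0 \<le> x * (x - 1)"
    by (cases "x \<ge> 1") (auto intro: mult_nonneg_nonneg mult_nonpos_nonpos)
  then show "0 \<le> x * (x - 1) div 2"
    by simp
  have "0 \<le> (x - 1) * (x - 2)"
    by (cases "x \<ge> 2") (auto intro: mult_nonneg_nonneg mult_nonpos_nonpos)
  moreover have "0 \<le> x * (x + 1)"
    by (cases "x \<ge> 0") (auto intro: mult_nonneg_nonneg mult_nonpos_nonpos)
  ultimately have "2 * (\<bar>x\<bar> - 1) \<le> x * (x - 1)"
    by (auto simp: algebra_simps abs_if)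
  then have "2 * (\<bar>x\<bar> - 1) div 2 \<le> x * (x - 1) div 2"
    by (rule zdiv_mono1) simp
  then show "\<bar>x\<bar> \<le> x * (x - 1) div 2 + 1"
    by simp
qed

end

theory Submission
  imports Defs
begin

text \<open>
  Completing squares turns \<open>t(1,3,9;n)\<close> and \<open>t(1,3,27;3n+1)\<close> into counts of odd solutions of
  \<open>x\<^sup>2 + 3y\<^sup>2 + 9z\<^sup>2 = M\<close> and \<open>x\<^sup>2 + 3y\<^sup>2 + 27z\<^sup>2 = 3M\<close>, where \<open>M = 8n + 13\<close>; in the second equation
  \<open>3\<close> divides \<open>x\<close>, which gives the first equality. Since \<open>M \<equiv> 5 (mod 8)\<close>, a solution of
  \<open>x\<^sup>2 + 3y\<^sup>2 + 9z\<^sup>2 = M\<close> that is not all odd has exactly one odd entry, namely \<open>x\<close> or \<open>z\<close>.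
  For \<open>k \<equiv> 4 (mod 8)\<close> multiplication by a primitive cube root of unity in \<open>\<int>[(1 + \<surd>-3)/2]\<close> shows
  that \<open>k = u\<^sup>2 + 3v\<^sup>2\<close> has twice as many odd as even solutions. Applied to \<open>x\<^sup>2 + 3y\<^sup>2\<close> and to
  \<open>y\<^sup>2 + 3z\<^sup>2\<close>, this makes each of the two remaining classes half as large as the all-odd class.
\<close>

section \<open>Representations as triples, and triangular numbers as odd squares\<close>

lemma card_length3_eq_card_triples:
  "card {xs :: 'a list. length xs = 3 \<and> P (xs ! 0) (xs ! 1) (xs ! 2)} = card {(x, y, z). P x y z}"
proof (rule bij_betw_same_card[symmetric])
  show "bij_betw (\<lambda>(x, y, z). [x, y, z]) {(x, y, z). P x y z}
    {xs. length xs = 3 \<and> P (xs ! 0) (xs ! 1) (xs ! 2)}"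
    by (rule bij_betw_byWitness[where f' = "\<lambda>xs. (xs ! 0, xs ! 1, xs ! 2)"])
      (auto simp: numeral_3_eq_3 numeral_2_eq_2 length_Suc_conv)
qed

lemma num_sq_reps_triple:
  "num_sq_reps [a, b, c] n =
    card {(x :: int, y :: int, z :: int). int n = int a * x\<^sup>2 + int b * y\<^sup>2 + int c * z\<^sup>2}"
  unfolding num_sq_reps_def card_length3_eq_card_triples[symmetric]
  by (simp add: numeral_3_eq_3 numeral_2_eq_2 add.assoc)

lemma finite_sq_triples:
  assumes "a > 0" "b > 0" "c > 0"
  shows "finite {(x :: int, y :: int, z :: int). int n = int a * x\<^sup>2 + int b * y\<^sup>2 + int c * z\<^sup>2}"
proof (rule finite_surj)
  show "finite {xs :: int list. length xs = length [a, b, c] \<and>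
    int n = (\<Sum>i<length [a, b, c]. int ([a, b, c] ! i) * (xs ! i)\<^sup>2)}"
    by (rule finite_sq_reps) (use assms in auto)
  show "{(x :: int, y :: int, z :: int). int n = int a * x\<^sup>2 + int b * y\<^sup>2 + int c * z\<^sup>2}
    \<subseteq> (\<lambda>xs. (xs ! 0, xs ! 1, xs ! 2)) ` {xs :: int list. length xs = length [a, b, c] \<and>
      int n = (\<Sum>i<length [a, b, c]. int ([a, b, c] ! i) * (xs ! i)\<^sup>2)}"
  proof clarify
    fix x y z :: int
    assume "int n = int a * x\<^sup>2 + int b * y\<^sup>2 + int c * z\<^sup>2"
    then show "(x, y, z) \<in> (\<lambda>xs. (xs ! 0, xs ! 1, xs ! 2)) ` {xs :: int list.
      length xs = length [a, b, c] \<and>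
      int n = (\<Sum>i<length [a, b, c]. int ([a, b, c] ! i) * (xs ! i)\<^sup>2)}"
      by (intro image_eqI[where x = "[x, y, z]"])
        (auto simp: numeral_3_eq_3 numeral_2_eq_2)
  qed
qed

lemma eight_times_triangular: "8 * (x * (x - 1) div 2) = (2 * x - 1)\<^sup>2 - (1 :: int)"
proof -
  have "even (x * (x - 1))"
    by simp
  then have "2 * (x * (x - 1) div 2) = x * (x - 1)"
    by (rule dvd_mult_div_cancel)
  then have "8 * (x * (x - 1) div 2) = 4 * (x * (x - 1))"
    by linarith
  then show ?thesis
    by (simp add: power2_eq_square algebra_simps)
qed

text \<open>Multiplying the triangular equation by 8 and adding \<open>a + b + c\<close> completes
  all three squares, and \<open>2 * x - 1\<close> runs through each odd integer exactly once as
  \<open>x\<close> runs through the integers.\<close>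

lemma num_tri_reps_triple:
  "num_tri_reps [a, b, c] n =
    card {(x :: int, y :: int, z :: int). odd x \<and> odd y \<and> odd z \<and>
      int (8 * n + a + b + c) = int a * x\<^sup>2 + int b * y\<^sup>2 + int c * z\<^sup>2}"
    (is "_ = card ?O")
proof -
  let ?t = "\<lambda>x :: int. x * (x - 1) div 2"
  let ?T = "{(x, y, z). int n = int a * ?t x + int b * ?t y + int c * ?t z}"
  have key: "int n = int a * ?t x + int b * ?t y + int c * ?t z \<longleftrightarrow>
    int (8 * n + a + b + c) =
      int a * (2 * x - 1)\<^sup>2 + int b * (2 * y - 1)\<^sup>2 + int c * (2 * z - 1)\<^sup>2" for x y z
  proof -
    have sq: "(2 * w - 1)\<^sup>2 = 8 * ?t w + 1" for w
      using eight_times_triangular[of w] by linarith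
    show ?thesis
      unfolding sq by (auto simp: algebra_simps)
  qed
  have half: "2 * ((x + 1) div 2) - 1 = x" if "odd x" for x :: int
    using that by presburger
  have "num_tri_reps [a, b, c] n = card ?T"
    unfolding num_tri_reps_def card_length3_eq_card_triples[symmetric]
    by (simp add: numeral_3_eq_3 numeral_2_eq_2 add.assoc)
  also have "\<dots> = card ?O"
  proof (rule bij_betw_same_card)
    show "bij_betw (\<lambda>(x, y, z). (2 * x - 1, 2 * y - 1, 2 * z - 1)) ?T ?O"
    proof (rule bij_betw_byWitness[where
          f' = "\<lambda>(x, y, z). ((x + 1) div 2, (y + 1) div 2, (z + 1) div 2)"])
      show "(\<lambda>(x, y, z). ((x + 1) div 2, (y + 1) div 2, (z + 1) div 2)) ` ?O \<subseteq> ?T"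
        by (auto simp only: key half image_iff mem_Collect_eq prod.case split_beta not_False_eq_True)
      show "(\<lambda>(x, y, z). (2 * x - 1, 2 * y - 1, 2 * z - 1)) ` ?T \<subseteq> ?O"
        by (auto simp only: key image_iff mem_Collect_eq prod.case) simp_all
    qed (auto simp: add.commute[of 1])
  qed
  finally show ?thesis .
qed

section \<open>Odd and even solutions of \<open>k = x\<^sup>2 + 3 * y\<^sup>2\<close> for
  \<open>k\<close> congruent to 4 modulo 8\<close>

text \<open>The odd pairs split into two classes of equal size, each matched with the even pairs by
  rotating \<open>x + y * sqrt(-3)\<close> through a unit of norm 1. The relation \<open>R\<close>
  lets \<open>k\<close> vary with a parameter \<open>c\<close>, so that a third variable of a
  ternary form can be carried along.\<close>

lemma card_odd_eq_twice_card_even: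
  fixes R :: "int \<Rightarrow> 'a \<Rightarrow> bool"
  assumes mod8: "\<And>k c. R k c \<Longrightarrow> k mod 8 = 4"
    and fin: "finite {(x, y, c). R (x\<^sup>2 + 3 * y\<^sup>2) c}"
  shows "card {(x, y, c). R (x\<^sup>2 + 3 * y\<^sup>2) c \<and> odd x \<and> odd y} =
    2 * card {(x, y, c). R (x\<^sup>2 + 3 * y\<^sup>2) c \<and> even x \<and> even y}"
    (is "card ?O = 2 * card ?E")
proof -
  \<comment> \<open>For odd \<open>x\<close> and \<open>y\<close>, exactly one of
    \<open>x - y\<close> and \<open>x + y\<close> is divisible by 4, and negating \<open>y\<close>
    swaps the two cases.\<close>
  define P where "P = {(x, y, c). R (x\<^sup>2 + 3 * y\<^sup>2) c \<and> odd x \<and> odd y \<and> 4 dvd x - y}"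
  define Q where "Q = {(x, y, c). R (x\<^sup>2 + 3 * y\<^sup>2) c \<and> odd x \<and> odd y \<and> 4 dvd x + y}"
  have "4 dvd x - y \<or> 4 dvd x + y" "\<not> (4 dvd x - y \<and> 4 dvd x + y)"
    if "odd x" "odd y" for x y :: int
    using that by presburger+
  then have "?O = P \<union> Q" "P \<inter> Q = {}"
    unfolding P_def Q_def by blast+
  moreover have "finite P" "finite Q"
    unfolding P_def Q_def by (auto intro: finite_subset[OF _ fin])
  ultimately have "card ?O = card P + card Q"
    by (simp add: card_Un_disjoint)
  moreover have "bij_betw (\<lambda>(x, y, c). (x, - y, c)) P Q"
    by (rule bij_betw_byWitness[where f' = "\<lambda>(x, y, c). (x, - y, c)"]) (auto simp: P_def Q_def)
  then have "card P = card Q"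
    by (rule bij_betw_same_card)
  \<comment> \<open>This map multiplies \<open>x + y * sqrt(-3)\<close> by the sixth root of unity
    \<open>(1 + sqrt(-3)) / 2\<close>, the negative of a primitive cube root; the inverse multiplies
    by the conjugate.\<close>
  moreover have "bij_betw (\<lambda>(x, y, c). ((x - 3 * y) div 2, (x + y) div 2, c)) ?E P"
  proof (rule bij_betw_byWitness[where
        f' = "\<lambda>(u, v, c). ((u + 3 * v) div 2, (v - u) div 2, c)"])
    show "(\<lambda>(x, y, c). ((x - 3 * y) div 2, (x + y) div 2, c)) ` ?E \<subseteq> P"
    proof clarify
      fix x y c
      assume R: "R (x\<^sup>2 + 3 * y\<^sup>2) c" and "even x" "even y"
      then obtain a b where ab: "x = 2 * a" "y = 2 * b"
        by (auto elim!: evenE)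
      \<comment> \<open>If \<open>a + b\<close> were even, the norm
        \<open>4 * (a\<^sup>2 + 3 * b\<^sup>2)\<close> would be divisible by 8. Hence
        \<open>a - 3 * b\<close> and \<open>a + b\<close> are both odd, and they differ by
        \<open>4 * b\<close>, as membership in \<open>P\<close> demands.\<close>
      have "odd (a + b)"
      proof
        assume "even (a + b)"
        then obtain d where d: "a = 2 * d - b"
          by (metis evenE add_diff_cancel_right')
        have "x\<^sup>2 + 3 * y\<^sup>2 = 8 * (2 * d\<^sup>2 - 2 * d * b + 2 * b\<^sup>2)"
          unfolding ab d by (simp add: power2_eq_square algebra_simps)
        with mod8[OF R] show False
          by simp
      qed
      moreover have "(a - 3 * b)\<^sup>2 + 3 * (a + b)\<^sup>2 = x\<^sup>2 + 3 * y\<^sup>2"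
        unfolding ab by (simp add: power2_eq_square algebra_simps)
      moreover have "(x - 3 * y) div 2 = a - 3 * b" "(x + y) div 2 = a + b"
        unfolding ab by simp_all
      ultimately show "((x - 3 * y) div 2, (x + y) div 2, c) \<in> P"
        using R by (auto simp: P_def)
    qed
    show "(\<lambda>(u, v, c). ((u + 3 * v) div 2, (v - u) div 2, c)) ` P \<subseteq> ?E"
    proof (clarsimp simp: P_def)
      fix u v c
      assume R: "R (u\<^sup>2 + 3 * v\<^sup>2) c" and "4 dvd u - v"
      then obtain b where "u - v = 4 * b"
        by (auto elim: dvdE)
      then have u: "u = v + 4 * b"
        by simp
      have "(u + 3 * v) div 2 = 2 * (v + b)" "(v - u) div 2 = - 2 * b"
        unfolding u by simp_all
      moreover have "(2 * (v + b))\<^sup>2 + 3 * (- 2 * b)\<^sup>2 = u\<^sup>2 + 3 * v\<^sup>2"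
        unfolding u by (simp add: power2_eq_square algebra_simps)
      ultimately show "R (((u + 3 * v) div 2)\<^sup>2 + 3 * ((v - u) div 2)\<^sup>2) c \<and>
        even ((u + 3 * v) div 2) \<and> even ((v - u) div 2)"
        using R by simp
    qed
    have "((x - 3 * y) div 2 + 3 * ((x + y) div 2)) div 2 = x"
      "((x + y) div 2 - (x - 3 * y) div 2) div 2 = y" if "even x" "even y" for x y :: int
    proof -
      obtain a b where ab: "x = 2 * a" "y = 2 * b"
        using \<open>even x\<close> \<open>even y\<close> by (auto elim!: evenE)
      have "(x - 3 * y) div 2 = a - 3 * b" "(x + y) div 2 = a + b"
        unfolding ab by simp_all
      then show "((x - 3 * y) div 2 + 3 * ((x + y) div 2)) div 2 = x"
        "((x + y) div 2 - (x - 3 * y) div 2) div 2 = y"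
        using ab by simp_all
    qed
    then show "\<forall>p\<in>?E. (\<lambda>(u, v, c). ((u + 3 * v) div 2, (v - u) div 2, c))
      ((\<lambda>(x, y, c). ((x - 3 * y) div 2, (x + y) div 2, c)) p) = p"
      by auto
    have "((u + 3 * v) div 2 - 3 * ((v - u) div 2)) div 2 = u"
      "((u + 3 * v) div 2 + (v - u) div 2) div 2 = v" if "4 dvd u - v" for u v :: int
    proof -
      obtain b where "u - v = 4 * b"
        using \<open>4 dvd u - v\<close> by (elim dvdE)
      then have u: "u = v + 4 * b"
        by simp
      have "(u + 3 * v) div 2 = 2 * (v + b)" "(v - u) div 2 = - 2 * b"
        unfolding u by simp_all
      then show "((u + 3 * v) div 2 - 3 * ((v - u) div 2)) div 2 = u"
        "((u + 3 * v) div 2 + (v - u) div 2) div 2 = v"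
        using u by simp_all
    qed
    then show "\<forall>p\<in>P. (\<lambda>(x, y, c). ((x - 3 * y) div 2, (x + y) div 2, c))
      ((\<lambda>(u, v, c). ((u + 3 * v) div 2, (v - u) div 2, c)) p) = p"
      unfolding P_def by auto
  qed
  then have "card ?E = card P"
    by (rule bij_betw_same_card)
  ultimately show ?thesis
    by simp
qed

section \<open>Parity classes of the solutions of
  \<open>m = x\<^sup>2 + 3 * y\<^sup>2 + 9 * z\<^sup>2\<close>\<close>

lemma odd_square_mod_8: "x\<^sup>2 mod 8 = 1" if "odd x" for x :: int
proof -
  obtain a where x: "x = 2 * a + 1"
    using \<open>odd x\<close> by (elim oddE)
  have "even (a * (a + 1))"
    by simp
  then obtain b where "a * (a + 1) = 2 * b"
    by (elim evenE)
  then have "x\<^sup>2 = 8 * b + 1"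
    unfolding x by (simp add: power2_eq_square algebra_simps)
  then show ?thesis
    by simp
qed

text \<open>A square is 0 or 1 modulo 4 according to parity, so the form modulo 4 is determined by
  the three parities; the residue 1 leaves just these patterns.\<close>

lemma parities_1_3_9:
  fixes x y z :: int
  assumes "(x\<^sup>2 + 3 * y\<^sup>2 + 9 * z\<^sup>2) mod 8 = 5"
  shows "odd x \<and> odd y \<and> odd z \<or> odd x \<and> even y \<and> even z \<or> even x \<and> even y \<and> odd z"
proof -
  \<comment> \<open>With parity as the number \<open>of_bool (odd w)\<close>, a single divisibility
    by 4 settles all eight parity patterns.\<close>
  have square: "\<exists>k. w\<^sup>2 = 4 * k + of_bool (odd w)" for w :: int
  proof (cases "even w")
    case True
    then show ?thesis
      by (auto elim!: evenE simp: power2_eq_square)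
  next
    case False
    then have "w\<^sup>2 = 4 * (2 * (w\<^sup>2 div 8)) + 1"
      using odd_square_mod_8[of w] mult_div_mod_eq[of 8 "w\<^sup>2"] by linarith
    with False show ?thesis
      by (metis of_bool_eq(2))
  qed
  obtain a b c where "x\<^sup>2 = 4 * a + of_bool (odd x)" "y\<^sup>2 = 4 * b + of_bool (odd y)"
    "z\<^sup>2 = 4 * c + of_bool (odd z)"
    using square by meson
  moreover obtain d where "x\<^sup>2 + 3 * y\<^sup>2 + 9 * z\<^sup>2 = 8 * d + 5"
    using assms mult_div_mod_eq[of 8 "x\<^sup>2 + 3 * y\<^sup>2 + 9 * z\<^sup>2"] by metis
  ultimately have "4 * (a + 3 * b + 9 * c - 2 * d - 1) =
    1 - of_bool (odd x) - 3 * of_bool (odd y) - 9 * of_bool (odd z)"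
    by (simp add: algebra_simps)
  then have "4 dvd (1 - of_bool (odd x) - 3 * of_bool (odd y) - 9 * of_bool (odd z) :: int)"
    by (metis dvd_triv_left)
  then show ?thesis
    by (cases "even x"; cases "even y"; cases "even z") simp_all
qed

text \<open>The two classes with a single odd entry are each half as large as the all-odd class, so
  together they double it.\<close>

lemma card_reps_1_3_9_eq_twice_odd:
  fixes m :: nat
  assumes m: "m mod 8 = 5"
  shows "card {(x :: int, y :: int, z :: int). int m = x\<^sup>2 + 3 * y\<^sup>2 + 9 * z\<^sup>2} =
    2 * card {(x :: int, y :: int, z :: int). odd x \<and> odd y \<and> odd z \<and>
      int m = x\<^sup>2 + 3 * y\<^sup>2 + 9 * z\<^sup>2}" (is "card ?N = 2 * card ?O")
proof -
  have m8: "int m mod 8 = 5"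
    using m by (metis of_nat_mod of_nat_numeral)
  have square: "\<exists>a. w\<^sup>2 = 8 * a + 1" if "odd w" for w :: int
    using odd_square_mod_8[OF that] by (metis mult_div_mod_eq)
  obtain q where q: "int m = 8 * q + 5"
    using m8 by (metis mult_div_mod_eq)
  have residue_9: "k mod 8 = 4" if "odd z" "int m = k + 9 * z\<^sup>2" for k z
  proof -
    obtain a where "z\<^sup>2 = 8 * a + 1"
      using square \<open>odd z\<close> by blast
    then have "k = 8 * (q - 9 * a - 1) + 4"
      using that(2) q by simp
    then show ?thesis
      by (simp only: mod_mult_self4) simp
  qed
  have residue_3: "k mod 8 = 4" if "odd x" "int m = x\<^sup>2 + 3 * k" for k x
  proof -
    obtain a where "x\<^sup>2 = 8 * a + 1"
      using square \<open>odd x\<close> by blast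
    \<comment> \<open>Since 3 is its own inverse modulo 8, \<open>3 * k = 8 * (q - a) + 4\<close> is
      multiplied by 3 and \<open>8 * k\<close> is subtracted.\<close>
    then have "k = 8 * (3 * (q - a) - k + 1) + 4"
      using that(2) q by simp
    then show ?thesis
      by (metis mod_mult_self4 mod_pos_pos_trivial zero_le_numeral numeral_less_iff
          semiring_norm(76,78))
  qed
  define A where "A = {(x :: int, y :: int, z :: int). odd x \<and> even y \<and> even z \<and>
    int m = x\<^sup>2 + 3 * y\<^sup>2 + 9 * z\<^sup>2}"
  define B where "B = {(x :: int, y :: int, z :: int). even x \<and> even y \<and> odd z \<and>
    int m = x\<^sup>2 + 3 * y\<^sup>2 + 9 * z\<^sup>2}"
  have finN: "finite ?N"
    using finite_sq_triples[of 1 3 9 m] by simp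
  have "odd x \<and> odd y \<and> odd z \<or> odd x \<and> even y \<and> even z \<or> even x \<and> even y \<and> odd z"
    if "int m = x\<^sup>2 + 3 * y\<^sup>2 + 9 * z\<^sup>2" for x y z
    using parities_1_3_9 m8 unfolding that by blast
  then have "?N = ?O \<union> (A \<union> B)"
    unfolding A_def B_def by blast
  moreover have "?O \<inter> (A \<union> B) = {}" "A \<inter> B = {}"
    unfolding A_def B_def by auto
  moreover have "finite ?O" "finite A" "finite B"
    unfolding A_def B_def by (auto intro: finite_subset[OF _ finN])
  ultimately have "card ?N = card ?O + (card A + card B)"
    by (simp add: card_Un_disjoint)
  moreover have "card ?O = 2 * card B"
  proof -
    \<comment> \<open>Here \<open>z\<close> is the parameter, and the binary form is the part in
      \<open>x\<close> and \<open>y\<close>.\<close>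
    let ?R = "\<lambda>k z :: int. odd z \<and> int m = k + 9 * z\<^sup>2"
    have "card {(x, y, z). ?R (x\<^sup>2 + 3 * y\<^sup>2) z \<and> odd x \<and> odd y} =
      2 * card {(x, y, z). ?R (x\<^sup>2 + 3 * y\<^sup>2) z \<and> even x \<and> even y}"
    proof (rule card_odd_eq_twice_card_even)
      show "k mod 8 = 4" if "?R k z" for k z
        using residue_9 that by blast
      show "finite {(x, y, z). ?R (x\<^sup>2 + 3 * y\<^sup>2) z}"
        by (auto intro: finite_subset[OF _ finN])
    qed
    moreover have "{(x, y, z). ?R (x\<^sup>2 + 3 * y\<^sup>2) z \<and> odd x \<and> odd y} = ?O"
      "{(x, y, z). ?R (x\<^sup>2 + 3 * y\<^sup>2) z \<and> even x \<and> even y} = B"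
      unfolding B_def by auto
    ultimately show ?thesis
      by simp
  qed
  moreover have "card ?O = 2 * card A"
  proof -
    \<comment> \<open>Now \<open>x\<close> is the parameter and \<open>3 * y\<^sup>2 + 9 * z\<^sup>2
      = 3 * (y\<^sup>2 + 3 * z\<^sup>2)\<close> supplies the binary form; \<open>?rot\<close> moves
      the pair \<open>y\<close>, \<open>z\<close> to the front.\<close>
    let ?R = "\<lambda>k x :: int. odd x \<and> int m = x\<^sup>2 + 3 * k"
    let ?rot = "\<lambda>(x, y, z). (y, z, x)"
    have rot: "card (?rot ` S) = card S" for S :: "(int \<times> int \<times> int) set"
      by (rule card_image) (auto simp: inj_on_def)
    have "card {(y, z, x). ?R (y\<^sup>2 + 3 * z\<^sup>2) x \<and> odd y \<and> odd z} =
      2 * card {(y, z, x). ?R (y\<^sup>2 + 3 * z\<^sup>2) x \<and> even y \<and> even z}"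
    proof (rule card_odd_eq_twice_card_even)
      show "k mod 8 = 4" if "?R k x" for k x
        using residue_3 that by blast
      have "{(y, z, x). ?R (y\<^sup>2 + 3 * z\<^sup>2) x} \<subseteq> ?rot ` ?N"
        by (auto simp: image_iff algebra_simps)
      then show "finite {(y, z, x). ?R (y\<^sup>2 + 3 * z\<^sup>2) x}"
        by (rule finite_subset) (intro finite_imageI finN)
    qed
    moreover have "{(y, z, x). ?R (y\<^sup>2 + 3 * z\<^sup>2) x \<and> odd y \<and> odd z} = ?rot ` ?O"
      "{(y, z, x). ?R (y\<^sup>2 + 3 * z\<^sup>2) x \<and> even y \<and> even z} = ?rot ` A"
      unfolding A_def by (auto simp: image_iff algebra_simps)
    ultimately show ?thesis
      by (simp only: rot)
  qed
  ultimately show ?thesis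
    by simp
qed

section \<open>Passage between the forms with coefficients 1, 3, 9 and 1, 3, 27\<close>

text \<open>In the second equation \<open>x = 3 * w\<close>, and division by 3 leaves
  \<open>m = y\<^sup>2 + 3 * w\<^sup>2 + 9 * z\<^sup>2\<close>. The first two variables thus trade
  places, and parity survives multiplication by 3.\<close>

lemma card_odd_reps_1_3_9_eq_1_3_27:
  fixes m :: int
  shows "card {(x :: int, y :: int, z :: int). odd x \<and> odd y \<and> odd z \<and>
      m = x\<^sup>2 + 3 * y\<^sup>2 + 9 * z\<^sup>2} =
    card {(x :: int, y :: int, z :: int). odd x \<and> odd y \<and> odd z \<and>
      3 * m = x\<^sup>2 + 3 * y\<^sup>2 + 27 * z\<^sup>2}" (is "card ?O = card ?O'")
proof (rule bij_betw_same_card)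
  have dvd3: "3 dvd x" if "3 * m = x\<^sup>2 + 3 * y\<^sup>2 + 27 * z\<^sup>2" for x y z
  proof -
    have "x\<^sup>2 = 3 * (m - y\<^sup>2 - 9 * z\<^sup>2)"
      using that by simp
    then have "x\<^sup>2 mod 3 = 0"
      by simp
    then have "(x mod 3)\<^sup>2 mod 3 = 0"
      by (simp add: power_mod)
    moreover have "x mod 3 \<in> {0, 1, 2}"
      by auto
    ultimately show "3 dvd x"
      by (auto simp: dvd_eq_mod_eq_0)
  qed
  show "bij_betw (\<lambda>(x, y, z). (3 * y, x, z)) ?O ?O'"
  proof (rule bij_betw_byWitness[where f' = "\<lambda>(x, y, z). (y, x div 3, z)"])
    show "\<forall>p\<in>?O'. (\<lambda>(x, y, z). (3 * y, x, z)) ((\<lambda>(x, y, z). (y, x div 3, z)) p) = p"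
      by (auto dest!: dvd3)
    show "(\<lambda>(x, y, z). (y, x div 3, z)) ` ?O' \<subseteq> ?O"
    proof (rule image_subsetI)
      fix p
      assume "p \<in> ?O'"
      then obtain x y z where p: "p = (x, y, z)" "odd x" "odd y" "odd z"
        and eq: "3 * m = x\<^sup>2 + 3 * y\<^sup>2 + 27 * z\<^sup>2"
        by auto
      moreover obtain w where "x = 3 * w"
        using dvd3[OF eq] by (elim dvdE)
      ultimately show "(\<lambda>(x, y, z). (y, x div 3, z)) p \<in> ?O"
        by (simp add: power_mult_distrib)
    qed
  qed (auto simp: power_mult_distrib)
qed

theorem theorem2p4:
  fixes n :: nat
  assumes "n > 0"
  shows "num_tri_reps [1, 3, 9] n = num_tri_reps [1, 3, 27] (3 * n + 1) \<and>
    real (num_tri_reps [1, 3, 27] (3 * n + 1)) = 1 / 2 * real (num_sq_reps [1, 3, 9] (8 * n + 13))"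
proof -
  let ?m = "8 * n + 13"
  have "?m mod 8 = 5"
    by presburger
  note twice = card_reps_1_3_9_eq_twice_odd[OF this]
  \<comment> \<open>The argument \<open>3 * n + 1\<close> is chosen so that the completed squares
    sum to exactly three times \<open>?m\<close>.\<close>
  have m3: "8 * (3 * n + 1) + 1 + 3 + 27 = 3 * ?m" and m1: "8 * n + 1 + 3 + 9 = ?m"
    by simp_all
  have tri9: "num_tri_reps [1, 3, 9] n = card {(x :: int, y :: int, z :: int).
      odd x \<and> odd y \<and> odd z \<and> int ?m = x\<^sup>2 + 3 * y\<^sup>2 + 9 * z\<^sup>2}"
    unfolding num_tri_reps_triple m1 by simp
  have tri27: "num_tri_reps [1, 3, 27] (3 * n + 1) = card {(x :: int, y :: int, z :: int).
      odd x \<and> odd y \<and> odd z \<and> 3 * int ?m = x\<^sup>2 + 3 * y\<^sup>2 + 27 * z\<^sup>2}"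
    unfolding num_tri_reps_triple m3 by simp
  have "num_sq_reps [1, 3, 9] ?m =
      card {(x :: int, y :: int, z :: int). int ?m = x\<^sup>2 + 3 * y\<^sup>2 + 9 * z\<^sup>2}"
    unfolding num_sq_reps_triple by simp
  then have "num_sq_reps [1, 3, 9] ?m = 2 * num_tri_reps [1, 3, 9] n"
    unfolding tri9 using twice by simp
  moreover have "num_tri_reps [1, 3, 9] n = num_tri_reps [1, 3, 27] (3 * n + 1)"
    unfolding tri9 tri27 by (rule card_odd_reps_1_3_9_eq_1_3_27)
  ultimately show ?thesis
    by simp
qed

end
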